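(* Let $H=\{x+iy: x>0,\ -1<y<1\}\subset\mathbb{C}$ and let $E=\{iy: -1<y<1\}$. Let $\varepsilon\in(0,1)$ and let $g$ be analytic in $H$ and extend analytically to $E$, with $\|g\|_H\le 1$ and $\|g\|_E\le\varepsilon$. Then for any real $x>0$, $$\log|g(x)|\le\alpha(x)\log\varepsilon,\quad\text{i.e.,}\quad |g(x)|\le\varepsilon^{\alpha(x)},$$ where $$\alpha(x)=\frac{4}{\pi}e^{-\pi x/2}-\left(\frac{4}{\pi}-1\right)e^{-\pi x}.$$ Conversely, for any $\varepsilon\in(0,1)$, there is a function $g$ satisfying the given conditions (analytic in $H$, extending analytically to $E$, $\|g\|_H\le 1$, $\|g\|_E\le\varepsilon$) for which, for all real $x\ge 0$, $$\log|g(x)|\ge\beta(x)\log\varepsilon,\quad\text{i.e.,}\quad |g(x)|\ge\varepsilon^{\beta(x)},$$ with $$\beta(x)=\frac{4}{\pi}e^{-\pi x/2}.$$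
   Context: For a set $A\subset\mathbb{C}$, $\|\cdot\|_A$ denotes the supremum norm over $A$: $\|g\|_A=\sup_{z\in A}|g(z)|$. That $g$ extends analytically to $E$ means that $g$ extends to a function analytic in an open set containing $H\cup E$; the values of $g$ on $E$ are those of the extension. The convention $\log 0=-\infty$ is used. *)

theory Defs
  imports "HOL-Analysis.Analysis"
begin

definition half_strip :: "complex set" where
  "half_strip = {z. 0 < Re z \<and> - 1 < Im z \<and> Im z < 1}"

definition strip_end :: "complex set" where
  "strip_end = {z. Re z = 0 \<and> - 1 < Im z \<and> Im z < 1}"

(* The supremum is taken in the extended reals, so that it is infinity for a function
   that is unbounded on A (the supremum of an unbounded set of reals is unspecified). *)
definition sup_norm :: "complex set \<Rightarrow> (complex \<Rightarrow> complex) \<Rightarrow> ereal" where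
  "sup_norm A g = (SUP z\<in>A. ereal (cmod (g z)))"

(* Functions are total, so g already has values on E. The condition below makes these the
   values of the analytic extension of the restriction of g to H; the values of g
   outside the union of H and E play no role. *)
definition extends_analytically ::
    "(complex \<Rightarrow> complex) \<Rightarrow> complex set \<Rightarrow> complex set \<Rightarrow> bool" where
  "extends_analytically g H E \<longleftrightarrow>
     (\<exists>U h. open U \<and> H \<union> E \<subseteq> U \<and> h analytic_on U \<and> (\<forall>z\<in>H \<union> E. h z = g z))"

(* The logarithm of nonnegative reals, with log 0 = -infinity; the real function ln
   of the library has ln 0 = 0. *)
definition log_ext :: "real \<Rightarrow> ereal" where
  "log_ext t = (if t = 0 then - \<infinity> else ereal (ln t))"

definition alpha :: "real \<Rightarrow> real" where
  "alpha x = 4 / pi * exp (- (pi * x / 2)) - (4 / pi - 1) * exp (- (pi * x))"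

definition beta :: "real \<Rightarrow> real" where
  "beta x = 4 / pi * exp (- (pi * x / 2))"

definition admissible :: "real \<Rightarrow> (complex \<Rightarrow> complex) \<Rightarrow> bool" where
  "admissible \<epsilon> g \<longleftrightarrow>
     g analytic_on half_strip \<and> extends_analytically g half_strip strip_end \<and>
     sup_norm half_strip g \<le> 1 \<and> sup_norm strip_end g \<le> ereal \<epsilon>"

end

theory Submission
  imports Defs "HOL-Complex_Analysis.Complex_Analysis"
begin

text \<open>
  The map \<open>z \<mapsto> w = exp (- \<pi> z / 2)\<close> sends the half-strip to the right half of the unit disc and
  its end to the unit semicircle, so the harmonic measure of the end is
  \<open>4/\<pi> * Re (Arctan w)\<close>, with value \<open>4/\<pi> * arctan (exp (- \<pi> x / 2))\<close> at a real
  point \<open>x\<close>. The upper bound is the two-constants theorem: multiply \<open>g\<close> by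
  \<open>\<epsilon>\<close> to the power \<open>- 4/\<pi> * Arctan w\<close> and apply the maximum principle; replacing \<open>w\<close> by
  \<open>\<lambda> w\<close> with \<open>\<lambda> < 1\<close> removes the jumps at the two corners. The function
  \<open>\<epsilon>\<close> to the power \<open>4/\<pi> * Arctan w\<close> is extremal. Finally \<open>alpha\<close> and \<open>beta\<close> come from
  \<open>q - (1 - \<pi>/4) q\<^sup>2 \<le> arctan q \<le> q\<close> on \<open>[0,1]\<close>.
\<close>

section \<open>Real part of \<open>Arctan\<close> on the right half of the unit disc\<close>

text \<open>\<open>Arctan w\<close> is a constant multiple of \<open>Ln\<close> of this quotient, so
  its real part is read off from the argument of the quotient.\<close>

lemma Arctan_Moebius_Re_Im:
  fixes w :: complex
  shows "Re ((1 - \<i>*w) / (1 + \<i>*w)) = (1 - (cmod w)\<^sup>2) / (cmod (1 + \<i>*w))\<^sup>2"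
    and "Im ((1 - \<i>*w) / (1 + \<i>*w)) = - 2 * Re w / (cmod (1 + \<i>*w))\<^sup>2"
  unfolding complex_div_cnj [of "1 - \<i>*w"] of_real_power [symmetric] Re_divide_of_real Im_divide_of_real
  by (simp_all add: cmod_power2 [of w] algebra_simps power2_eq_square
        cmod_power2 [of w, unfolded power2_eq_square])

lemma Re_Arctan_eq_Arg:
  assumes "\<i> * w \<noteq> 1" "\<i> * w \<noteq> - 1"
  shows "Re (Arctan w) = - Arg ((1 - \<i>*w) / (1 + \<i>*w)) / 2"
proof -
  have "(1 - \<i>*w) / (1 + \<i>*w) \<noteq> 0"
    using assms by (auto simp: add_eq_0_iff)
  then show ?thesis
    by (simp add: Arctan_def Arg_eq_Im_Ln)
qed

text \<open>The Moebius quotient has positive real part here, so its argument is the arctangent of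
  Im/Re without any branch correction.\<close>

lemma Re_Arctan_in_disc:
  assumes "cmod w < 1"
  shows "Re (Arctan w) = arctan (2 * Re w / (1 - (cmod w)\<^sup>2)) / 2"
proof -
  define c where "c = (1 - \<i>*w) / (1 + \<i>*w)"
  have ne: "\<i> * w \<noteq> 1" "\<i> * w \<noteq> - 1"
  proof -
    have "cmod (\<i> * w) < 1" using assms by (simp add: norm_mult)
    then show "\<i> * w \<noteq> 1" "\<i> * w \<noteq> - 1" by auto
  qed
  then have "cmod (1 + \<i>*w) \<noteq> 0" by (auto simp: add_eq_0_iff)
  then have "Im c / Re c = - (2 * Re w / (1 - (cmod w)\<^sup>2))"
    unfolding c_def Arctan_Moebius_Re_Im by (simp add: divide_simps)
  moreover have "Re c > 0"
    unfolding c_def using assms Re_complex_div_lemma by blast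
  ultimately show ?thesis
    using Re_Arctan_eq_Arg [OF ne] arg_conv_arctan [of c] by (simp add: arctan_minus c_def)
qed

text \<open>The Moebius quotient lands on the negative imaginary axis, where \<open>Arg\<close> is
  -pi/2. Scaled by 4/pi, this is the boundary value 1 of the harmonic measure.\<close>

lemma Re_Arctan_on_circle:
  assumes "cmod w = 1" "Re w > 0"
  shows "Re (Arctan w) = pi / 4"
proof -
  define c where "c = (1 - \<i>*w) / (1 + \<i>*w)"
  have ne: "\<i> * w \<noteq> 1" "\<i> * w \<noteq> - 1"
    using assms(2) by (auto simp: complex_eq_iff)
  then have n: "cmod (1 + \<i>*w) > 0" by (auto simp: add_eq_0_iff)
  then have "Re c = 0" "Im c < 0"
    unfolding c_def Arctan_Moebius_Re_Im using assms by (simp_all add: divide_neg_pos)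
  then have "Arg c = - (pi / 2)"
  proof -
    have "c = rcis (- Im c) (- (pi / 2))"
      using \<open>Re c = 0\<close> by (simp add: complex_eq_iff)
    then show ?thesis
      using \<open>Im c < 0\<close> pi_gt_zero by (intro Arg_unique' [of "- Im c"]) (auto simp: intro: order_trans [of _ 0])
  qed
  then show ?thesis
    using Re_Arctan_eq_Arg [OF ne] by (simp add: c_def)
qed

text \<open>The last bound, from arctan y <= y for y >= 0, gives smallness near the imaginary
  diameter, uniformly on discs of radius t < 1.\<close>

lemma Re_Arctan_half_disc_bounds:
  assumes "cmod w < 1" "Re w \<ge> 0"
  shows "0 \<le> Re (Arctan w)" "Re (Arctan w) \<le> pi / 4"
    "Re (Arctan w) \<le> Re w / (1 - (cmod w)\<^sup>2)"
proof -
  have "0 \<le> 2 * Re w / (1 - (cmod w)\<^sup>2)"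
    using assms by (simp add: abs_square_le_1 divide_nonneg_nonneg)
  then have "0 \<le> arctan (2 * Re w / (1 - (cmod w)\<^sup>2))"
       "arctan (2 * Re w / (1 - (cmod w)\<^sup>2)) \<le> 2 * Re w / (1 - (cmod w)\<^sup>2)"
    by (simp_all add: arctan_le_self)
  then show "0 \<le> Re (Arctan w)" "Re (Arctan w) \<le> pi / 4"
    "Re (Arctan w) \<le> Re w / (1 - (cmod w)\<^sup>2)"
    unfolding Re_Arctan_in_disc [OF assms(1)]
    using arctan_ubound [of "2 * Re w / (1 - (cmod w)\<^sup>2)"] by linarith+
qed

section \<open>The exponential map of the half-strip\<close>

definition strip_exp :: "complex \<Rightarrow> complex" where
  "strip_exp z = exp (- (of_real (pi / 2) * z))"

lemma cmod_strip_exp: "cmod (strip_exp z) = exp (- (pi / 2 * Re z))"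
  by (simp add: strip_exp_def)

lemma Re_strip_exp: "Re (strip_exp z) = exp (- (pi / 2 * Re z)) * cos (pi / 2 * Im z)"
  by (simp add: strip_exp_def Re_exp)

lemma Re_strip_exp_pos:
  assumes "\<bar>Im z\<bar> < 1"
  shows "0 < Re (strip_exp z)"
proof -
  have "\<bar>pi / 2 * Im z\<bar> < pi / 2"
    using assms by (simp add: abs_mult)
  then have "0 < cos (pi / 2 * Im z)"
    by (intro cos_gt_zero_pi) (auto simp: abs_less_iff)
  then show ?thesis by (simp add: Re_strip_exp)
qed

lemma Re_Arctan_strip_exp_of_real:
  "Re (Arctan (of_real t * strip_exp (of_real x))) = arctan (t * exp (- (pi / 2 * x)))"
proof -
  have "of_real t * strip_exp (of_real x) = of_real (t * exp (- (pi / 2 * x)))"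
    by (simp add: strip_exp_def exp_of_real [symmetric])
  then show ?thesis by (simp only: arctan_eq_Re_Arctan)
qed

lemma holomorphic_strip_exp: "strip_exp holomorphic_on S"
  unfolding strip_exp_def by (intro holomorphic_intros)

text \<open>The branch cuts of \<open>Arctan\<close> lie on the imaginary axis, whereas the argument
  stays in the open right half-plane.\<close>

lemma holomorphic_Arctan_strip_exp:
  assumes "t > 0" "\<And>z. z \<in> S \<Longrightarrow> \<bar>Im z\<bar> < 1"
  shows "(\<lambda>z. Arctan (of_real t * strip_exp z)) holomorphic_on S"
proof -
  have "(Arctan \<circ> (\<lambda>z. of_real t * strip_exp z)) holomorphic_on S"
  proof (rule holomorphic_on_compose)
    show "(\<lambda>z. of_real t * strip_exp z) holomorphic_on S"
      by (intro holomorphic_intros holomorphic_strip_exp)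
    show "Arctan holomorphic_on (\<lambda>z. of_real t * strip_exp z) ` S"
    proof (rule holomorphic_on_Arctan)
      fix w assume "w \<in> (\<lambda>z. of_real t * strip_exp z) ` S" "Re w = 0"
      then show "\<bar>Im w\<bar> < 1"
        using Re_strip_exp_pos assms by fastforce
    qed
  qed
  then show ?thesis by (simp add: o_def)
qed

text \<open>Re w tends to 0 towards the horizontal sides and towards infinity. A rectangle cut off
  slightly inside the strip thus has Re w small on three sides, and no boundary values of the
  function at |Im z| = 1 are needed.\<close>

lemma thin_right_half_plane_image:
  assumes "0 < \<eta>"
  obtains r R :: real where "0 < r" "r < 1" "x < R"
    "\<And>z. 0 \<le> Re z \<Longrightarrow> \<bar>Im z\<bar> = r \<Longrightarrow> Re (strip_exp z) \<le> \<eta>"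
    "\<And>z. Re z = R \<Longrightarrow> Re (strip_exp z) \<le> \<eta>"
proof
  \<comment> \<open>The width removed at each horizontal side; there cos (pi/2 Im z) = sin (pi/2 s)
    <= pi/2 s.\<close>
  define s where "s = min (1/2) (2 * \<eta> / pi)"
  have s: "0 < s" "s < 1" "pi / 2 * s \<le> \<eta>"
    using assms by (auto simp: s_def min_def field_simps)
  define R where "R = max (x + 1) (- (2 / pi * ln \<eta>))"
  show "0 < 1 - s" "1 - s < 1" "x < R"
    using s by (auto simp: R_def)
  show "Re (strip_exp z) \<le> \<eta>" if "0 \<le> Re z" "\<bar>Im z\<bar> = 1 - s" for z
  proof -
    have "cos (pi / 2 * Im z) = cos (pi / 2 * \<bar>Im z\<bar>)"
      by (cases "Im z \<ge> 0") auto
    also have "\<dots> = sin (pi / 2 * s)"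
      by (simp add: that sin_cos_eq right_diff_distrib diff_divide_distrib)
    also have "\<dots> \<le> pi / 2 * s"
      using s by (intro sin_x_le_x) auto
    finally have "cos (pi / 2 * Im z) \<le> \<eta>" using s by simp
    moreover have "exp (- (pi / 2 * Re z)) \<le> 1" using that by simp
    ultimately have "exp (- (pi / 2 * Re z)) * cos (pi / 2 * Im z) \<le> 1 * \<eta>"
      using assms by (meson exp_ge_zero mult_left_mono mult_right_mono order_trans less_imp_le)
    then show ?thesis by (simp add: Re_strip_exp)
  qed
  show "Re (strip_exp z) \<le> \<eta>" if "Re z = R" for z
  proof -
    have "- (pi / 2 * R) \<le> ln \<eta>"
      using max.cobounded2 [of "- (2 / pi * ln \<eta>)" "x + 1"] pi_gt_zero
      unfolding R_def [symmetric] by (simp add: field_simps)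
    then have "exp (- (pi / 2 * R)) \<le> \<eta>"
      using assms by (simp add: ln_ge_iff)
    then show ?thesis
      using complex_Re_le_cmod [of "strip_exp z"] that by (simp add: cmod_strip_exp)
  qed
qed

section \<open>The two-constants theorem\<close>

lemma two_constants_half_strip_approx:
  fixes h :: "complex \<Rightarrow> complex"
  assumes hol: "h holomorphic_on U" and U: "open U" "half_strip \<union> strip_end \<subseteq> U"
    and H: "\<And>z. z \<in> half_strip \<Longrightarrow> cmod (h z) \<le> 1"
    and E: "\<And>z. z \<in> strip_end \<Longrightarrow> cmod (h z) \<le> exp L" and L: "L < 0"
    and t: "0 < t" "t < 1" and d: "0 < d" and x: "0 < x"
  shows "cmod (h (of_real x)) \<le> exp (L * (4 / pi * arctan (t * exp (- (pi / 2 * x))) - d))"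
proof -
  \<comment> \<open>Chosen so that Re w <= \<eta> and |w| <= t give 4/pi * Re (Arctan w) <=
    d.\<close>
  define \<eta> where "\<eta> = pi / 4 * d * (1 - t\<^sup>2)"
  have t2: "0 < 1 - t\<^sup>2" using t by (simp add: power_less_one_iff)
  have "0 < \<eta>" using t2 d by (simp add: \<eta>_def)
  then obtain r R where rR: "0 < r" "r < 1" "x < R"
    and hor: "\<And>z. 0 \<le> Re z \<Longrightarrow> \<bar>Im z\<bar> = r \<Longrightarrow> Re (strip_exp z) \<le> \<eta>"
    and right: "\<And>z. Re z = R \<Longrightarrow> Re (strip_exp z) \<le> \<eta>"
    using thin_right_half_plane_image by blast
  define w where "w = (\<lambda>z. of_real t * strip_exp z)"
  \<comment> \<open>The shift by \<open>d\<close> absorbs the small positive values of the harmonic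
    function on the three sides other than the end.\<close>
  define f where "f = (\<lambda>z. h z * exp (- of_real L * (of_real (4 / pi) * Arctan (w z) - of_real d)))"
  have norm_f: "cmod (f z) = cmod (h z) * exp (- L * (4 / pi * Re (Arctan (w z)) - d))" for z
    by (simp add: f_def norm_mult)
  define S where "S = cbox (Complex 0 (- r)) (Complex R r)"
  have S: "z \<in> S \<longleftrightarrow> 0 \<le> Re z \<and> Re z \<le> R \<and> \<bar>Im z\<bar> \<le> r" for z
    by (auto simp: S_def in_cbox_complex_iff)
  have "S \<subseteq> half_strip \<union> strip_end"
    using rR by (auto simp: S half_strip_def strip_end_def)
  then have "S \<subseteq> U" using U by blast
  have "f holomorphic_on S"
    unfolding f_def w_def using \<open>S \<subseteq> U\<close> t rR
    by (intro holomorphic_intros holomorphic_on_subset [OF hol] holomorphic_Arctan_strip_exp)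
       (auto simp: S)
  then have "f holomorphic_on interior S" "continuous_on (closure S) f"
    using holomorphic_on_subset [OF _ interior_subset]
    by (auto simp: holomorphic_on_imp_continuous_on S_def simp del: interior_cbox)
  moreover have "bounded S" by (simp add: S_def bounded_cbox)
  moreover have "of_real x \<in> S" using x rR by (simp add: S)
  moreover have "cmod (f z) \<le> 1" if z: "z \<in> frontier S" for z
  proof -
    from z have zS: "z \<in> S"
      and edge: "Re z = 0 \<or> Re z = R \<or> \<bar>Im z\<bar> = r"
      by (auto simp: S_def frontier_cbox in_cbox_complex_iff in_box_complex_iff)
    have "\<bar>Im z\<bar> < 1" using zS rR by (auto simp: S)
    have w_le: "cmod (w z) \<le> t"
      using t zS by (simp add: w_def norm_mult cmod_strip_exp S)
    then have w1: "cmod (w z) < 1" using t by simp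
    have Rew: "0 \<le> Re (w z)" "Re (w z) \<le> Re (strip_exp z)"
      using t Re_strip_exp_pos [OF \<open>\<bar>Im z\<bar> < 1\<close>] by (auto simp: w_def mult_left_le_one_le)
    note bnd = Re_Arctan_half_disc_bounds [OF w1 Rew(1)]
    show ?thesis
    \<comment> \<open>On the end, |h| <= exp L pays for a factor of at most exp (-L). On the other
      sides |h| <= 1 and the factor is at most 1, since the exponent is nonpositive.\<close>
    proof (cases "Re z = 0")
      case True
      then have "z \<in> strip_end"
        using \<open>\<bar>Im z\<bar> < 1\<close> by (auto simp: strip_end_def)
      have "4 / pi * Re (Arctan (w z)) \<le> 1"
        using bnd(2) by (simp add: field_simps)
      then have "4 / pi * Re (Arctan (w z)) - d \<le> 1" using d by linarith
      then have "- L * (4 / pi * Re (Arctan (w z)) - d) \<le> - L * 1"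
        using L by (intro mult_left_mono) auto
      then have "cmod (f z) \<le> exp L * exp (- L)"
        unfolding norm_f using E [OF \<open>z \<in> strip_end\<close>] by (intro mult_mono) auto
      then show ?thesis by (simp add: exp_minus)
    next
      case False
      then have "z \<in> half_strip"
        using zS \<open>\<bar>Im z\<bar> < 1\<close> by (auto simp: half_strip_def S)
      have "Re (strip_exp z) \<le> \<eta>"
        using edge False hor right zS by (auto simp: S)
      have "Re (Arctan (w z)) \<le> Re (w z) / (1 - (cmod (w z))\<^sup>2)" by (rule bnd)
      also have "\<dots> \<le> \<eta> / (1 - t\<^sup>2)"
        using Rew w_le \<open>Re (strip_exp z) \<le> \<eta>\<close> t2 by (intro frac_le) (auto intro: power_mono)
      also have "\<dots> = pi / 4 * d" unfolding \<eta>_def using t2 by (intro nonzero_mult_div_cancel_right) simp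
      finally have "4 / pi * Re (Arctan (w z)) - d \<le> 0" by (simp add: field_simps)
      then have "- L * (4 / pi * Re (Arctan (w z)) - d) \<le> 0"
        using L by (intro mult_nonneg_nonpos) auto
      then have "cmod (f z) \<le> 1 * 1"
        unfolding norm_f using H [OF \<open>z \<in> half_strip\<close>] by (intro mult_mono) auto
      then show ?thesis by simp
    qed
  qed
  ultimately have "cmod (f (of_real x)) \<le> 1"
    by (metis maximum_modulus_frontier)
  then show ?thesis
    unfolding norm_f w_def Re_Arctan_strip_exp_of_real mult_minus_left exp_minus
      divide_inverse [symmetric] pos_divide_le_eq [OF exp_gt_zero] by simp
qed

lemma two_constants_half_strip:
  fixes h :: "complex \<Rightarrow> complex"
  assumes "h holomorphic_on U" "open U" "half_strip \<union> strip_end \<subseteq> U"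
    and "\<And>z. z \<in> half_strip \<Longrightarrow> cmod (h z) \<le> 1"
    and "\<And>z. z \<in> strip_end \<Longrightarrow> cmod (h z) \<le> exp L" "L < 0" "0 < x"
  shows "cmod (h (of_real x)) \<le> exp (L * (4 / pi * arctan (exp (- (pi / 2 * x)))))"
proof (rule tendsto_lowerbound)
  \<comment> \<open>Taking t = 1 - d turns both approximations into a single limit d -> 0.\<close>
  let ?b = "\<lambda>d. exp (L * (4 / pi * arctan ((1 - d) * exp (- (pi / 2 * x))) - d))"
  have "(?b \<longlongrightarrow> exp (L * (4 / pi * arctan ((1 - 0) * exp (- (pi / 2 * x))) - 0))) (at_right 0)"
    by (intro tendsto_intros)
  then show "(?b \<longlongrightarrow> exp (L * (4 / pi * arctan (exp (- (pi / 2 * x)))))) (at_right 0)"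
    by simp
  have "\<forall>\<^sub>F d in at_right (0::real). d \<in> {0<..<1}"
    by (rule eventually_at_right_real) simp
  then show "\<forall>\<^sub>F d in at_right 0. cmod (h (of_real x)) \<le> ?b d"
    by eventually_elim (rule two_constants_half_strip_approx [OF assms(1-6)], use assms in auto)
qed simp

section \<open>Comparison of the harmonic measure with \<open>alpha\<close> and
  \<open>beta\<close>\<close>

text \<open>The derivative of the difference has the sign of \<open>2 (1 - \<pi>/4) - q / (1 + q\<^sup>2)\<close>, which is
  decreasing on \<open>[0,1]\<close>, so the difference is smallest at an end point, where it vanishes.\<close>

lemma arctan_ge_quadratic:
  fixes q :: real
  assumes "0 \<le> q" "q \<le> 1"
  shows "q - (1 - pi / 4) * q\<^sup>2 \<le> arctan q"
proof -
  define c where "c = 1 - pi / 4"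
  define k where "k = (\<lambda>q::real. arctan q - q + c * q\<^sup>2)"
  have deriv: "(k has_real_derivative u * (2 * c - u / (1 + u\<^sup>2))) (at u)" for u
  proof -
    have "1 + u\<^sup>2 \<noteq> 0" by (smt (verit) zero_le_power2)
    then show ?thesis
      unfolding k_def
      by (auto intro!: derivative_eq_intros simp: field_simps power2_eq_square)
  qed
  have mono: "u / (1 + u\<^sup>2) \<le> v / (1 + v\<^sup>2)" if "0 \<le> u" "u \<le> v" "v \<le> 1" for u v :: real
  proof -
    \<comment> \<open>This product equals v (1 + u^2) - u (1 + v^2), the difference after
      cross-multiplication.\<close>
    have "0 \<le> (v - u) * (1 - u * v)"
      using that by (intro mult_nonneg_nonneg) (auto simp: mult_le_one)
    moreover have "0 < 1 + u\<^sup>2" "0 < 1 + v\<^sup>2" by (simp_all add: add_pos_nonneg)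
    ultimately show ?thesis
      by (simp add: divide_simps) (simp add: algebra_simps power2_eq_square)
  qed
  have "0 \<le> k q"
  proof (cases "q / (1 + q\<^sup>2) \<le> 2 * c")
    case True
    have "k 0 \<le> k q"
    proof (rule DERIV_nonneg_imp_nondecreasing [OF assms(1)])
      fix u assume u: "0 \<le> u" "u \<le> q"
      then have "0 \<le> u * (2 * c - u / (1 + u\<^sup>2))"
        using mono [OF u assms(2)] True by (intro mult_nonneg_nonneg) auto
      then show "\<exists>y. DERIV k u :> y \<and> y \<ge> 0" using deriv by blast
    qed
    then show ?thesis by (simp add: k_def)
  next
    case False
    have "k 1 \<le> k q"
    proof (rule DERIV_nonpos_imp_nonincreasing [OF assms(2)])
      fix u assume u: "q \<le> u" "u \<le> 1"
      then have "u * (2 * c - u / (1 + u\<^sup>2)) \<le> 0"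
        using mono [OF assms(1) u] False assms(1) by (intro mult_nonneg_nonpos) auto
      then show "\<exists>y. DERIV k u :> y \<and> y \<le> 0" using deriv by blast
    qed
    then show ?thesis by (simp add: k_def c_def arctan_one)
  qed
  then show ?thesis by (simp add: k_def c_def)
qed

text \<open>With q = exp (-pi x/2), \<open>alpha x\<close> is 4/pi times the quadratic minorant of
  arctan q.\<close>

lemma alpha_le_harmonic_measure:
  assumes "0 \<le> x"
  shows "alpha x \<le> 4 / pi * arctan (exp (- (pi / 2 * x)))"
proof -
  define q where "q = exp (- (pi / 2 * x))"
  have "q\<^sup>2 = exp (- (pi * x))"
    by (simp add: q_def power2_eq_square exp_add [symmetric])
  then have "alpha x = 4 / pi * (q - (1 - pi / 4) * q\<^sup>2)"
    by (simp add: alpha_def q_def field_simps)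
  also have "\<dots> \<le> 4 / pi * arctan q"
    using assms by (intro mult_left_mono arctan_ge_quadratic) (auto simp: q_def)
  finally show ?thesis by (simp add: q_def)
qed

lemma harmonic_measure_le_beta:
  "4 / pi * arctan (exp (- (pi / 2 * x))) \<le> beta x"
  unfolding beta_def by (intro mult_left_mono) (auto simp: arctan_le_self)

section \<open>Upper bound for admissible functions and the extremal function\<close>

lemma sup_norm_le_iff: "sup_norm A g \<le> ereal b \<longleftrightarrow> (\<forall>z\<in>A. cmod (g z) \<le> b)"
  by (simp add: sup_norm_def SUP_le_iff)

lemma admissible_upper_bound:
  assumes adm: "admissible \<epsilon> g" and \<epsilon>: "0 < \<epsilon>" "\<epsilon> < 1" and x: "0 < x"
  shows "cmod (g (of_real x)) \<le> exp (alpha x * ln \<epsilon>)"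
proof -
  from adm obtain U h where U: "open U" "half_strip \<union> strip_end \<subseteq> U" and "h analytic_on U"
    and h: "\<And>z. z \<in> half_strip \<union> strip_end \<Longrightarrow> h z = g z"
    unfolding admissible_def extends_analytically_def by blast
  then have "h holomorphic_on U" by (simp add: analytic_imp_holomorphic)
  then have "cmod (h (of_real x)) \<le> exp (ln \<epsilon> * (4 / pi * arctan (exp (- (pi / 2 * x)))))"
    using adm \<epsilon> x h
    by (intro two_constants_half_strip [OF _ U])
       (auto simp: admissible_def sup_norm_le_iff one_ereal_def)
  also have "\<dots> \<le> exp (ln \<epsilon> * alpha x)"
    \<comment> \<open>Since \<open>ln \<epsilon>\<close> is negative, a lower bound on the harmonic
      measure becomes an upper bound on |g|.\<close>
    unfolding exp_le_cancel_iff
    using \<epsilon> x alpha_le_harmonic_measure [of x] by (intro mult_left_mono_neg) auto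
  finally show ?thesis
    using h [of "of_real x"] x by (simp add: half_strip_def mult.commute)
qed

definition extremal :: "real \<Rightarrow> complex \<Rightarrow> complex" where
  "extremal \<epsilon> z = exp (of_real (ln \<epsilon> * (4 / pi)) * Arctan (strip_exp z))"

lemma cmod_extremal: "cmod (extremal \<epsilon> z) = exp (ln \<epsilon> * (4 / pi * Re (Arctan (strip_exp z))))"
  by (simp add: extremal_def)

lemma admissible_extremal:
  assumes \<epsilon>: "0 < \<epsilon>" "\<epsilon> < 1"
  shows "admissible \<epsilon> (extremal \<epsilon>)"
proof -
  \<comment> \<open>The full infinite strip serves as the open neighbourhood: Re w > 0 holds there
    even where Re z < 0.\<close>
  define U where "U = {z::complex. - 1 < Im z} \<inter> {z. Im z < 1}"
  have "open U"
    unfolding U_def by (intro open_Int open_halfspace_Im_lt open_halfspace_Im_gt)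
  have "(\<lambda>z. Arctan (strip_exp z)) holomorphic_on U"
    using holomorphic_Arctan_strip_exp [of 1 U] by (simp add: U_def abs_less_iff)
  then have "extremal \<epsilon> holomorphic_on U"
    unfolding extremal_def by (intro holomorphic_intros)
  then have an: "extremal \<epsilon> analytic_on U"
    using \<open>open U\<close> by (simp add: analytic_on_open)
  have sub: "half_strip \<union> strip_end \<subseteq> U"
    by (auto simp: half_strip_def strip_end_def U_def)
  have "cmod (extremal \<epsilon> z) \<le> 1" if "z \<in> half_strip" for z
  proof -
    have "0 \<le> Re (Arctan (strip_exp z))"
      using that Re_strip_exp_pos [of z]
      by (intro Re_Arctan_half_disc_bounds) (auto simp: half_strip_def cmod_strip_exp abs_less_iff)
    then show ?thesis
      using \<epsilon> by (simp add: cmod_extremal mult_nonpos_nonneg divide_nonpos_pos)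
  qed
  moreover have "cmod (extremal \<epsilon> z) \<le> \<epsilon>" if "z \<in> strip_end" for z
  proof -
    have "Re (Arctan (strip_exp z)) = pi / 4"
      using that Re_strip_exp_pos [of z]
      by (intro Re_Arctan_on_circle) (auto simp: strip_end_def cmod_strip_exp)
    then have "4 / pi * Re (Arctan (strip_exp z)) = 1" by simp
    then show ?thesis
      unfolding cmod_extremal using \<epsilon> by (simp only: mult_1_right exp_ln)
  qed
  ultimately show ?thesis
    unfolding admissible_def extends_analytically_def sup_norm_le_iff one_ereal_def
    using \<open>open U\<close> sub an analytic_on_subset [OF an] by blast
qed

lemma extremal_lower_bound:
  assumes "0 < \<epsilon>" "\<epsilon> < 1"
  shows "exp (beta x * ln \<epsilon>) \<le> cmod (extremal \<epsilon> (of_real x))"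
proof -
  have "ln \<epsilon> * beta x \<le> ln \<epsilon> * (4 / pi * arctan (exp (- (pi / 2 * x))))"
    using assms harmonic_measure_le_beta [of x] by (intro mult_left_mono_neg) auto
  then show ?thesis
    using Re_Arctan_strip_exp_of_real [of 1 x] by (simp add: cmod_extremal mult.commute)
qed

text \<open>At t = 0 both sides hold, as \<open>log_ext\<close> is then -infinity and exp is
  positive.\<close>

lemma log_ext_le_iff:
  assumes "0 \<le> t"
  shows "log_ext t \<le> ereal a \<longleftrightarrow> t \<le> exp a"
  using assms exp_le_cancel_iff [of "ln t" a] by (cases "t = 0") (auto simp: log_ext_def)

lemma le_log_ext_iff:
  assumes "0 \<le> t"
  shows "ereal a \<le> log_ext t \<longleftrightarrow> exp a \<le> t"
  using assms by (cases "t = 0") (auto simp: log_ext_def ln_ge_iff not_le)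

theorem theorem4p1:
  fixes \<epsilon> :: real
  assumes "0 < \<epsilon>" and "\<epsilon> < 1"
  shows "(\<forall>g. admissible \<epsilon> g \<longrightarrow>
            (\<forall>x::real. 0 < x \<longrightarrow>
               log_ext (cmod (g (complex_of_real x))) \<le> ereal (alpha x * ln \<epsilon>) \<and>
               cmod (g (complex_of_real x)) \<le> \<epsilon> powr alpha x)) \<and>
         (\<exists>g. admissible \<epsilon> g \<and>
            (\<forall>x::real. 0 \<le> x \<longrightarrow>
               log_ext (cmod (g (complex_of_real x))) \<ge> ereal (beta x * ln \<epsilon>) \<and>
               cmod (g (complex_of_real x)) \<ge> \<epsilon> powr beta x))"
proof -
  have "\<epsilon> powr a = exp (a * ln \<epsilon>)" for a
    using assms by (simp add: powr_def)
  then show ?thesis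
    using admissible_upper_bound [OF _ assms] admissible_extremal [OF assms]
      extremal_lower_bound [OF assms]
    by (auto simp: log_ext_le_iff le_log_ext_iff simp del: exp_le_cancel_iff)
qed

end
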